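(* Let $0\le z\le n$ and let $\mu$ be a partition of $n-z$. Then the ideal $I_{(\mu,z)}\subset K[x_1,\dots,x_n]$ is $G(r,1,n)$-invariant, i.e. $g(I_{(\mu,z)})=I_{(\mu,z)}$ for every $g\in G(r,1,n)$.
   Context: Standing assumptions: $r\ge 2$, and $K$ is an infinite field containing all $r$-th roots of unity (e.g. algebraically closed). $\mu_r\subset K^\times$ is the group of $r$-th roots of unity, and $$G(r,1,n)=(\mathbb{Z}/r\mathbb{Z})\wr S_n=\{(\eta_1,\dots,\eta_n;\sigma):\eta_i\in\mu_r,\ \sigma\in S_n\}$$ acts on $K[x_1,\dots,x_n]$ by $(\eta;\sigma)\cdot f(x_1,\dots,x_n)=f(\eta_{\sigma(1)}x_{\sigma(1)},\dots,\eta_{\sigma(n)}x_{\sigma(n)})$. Classical Specht ideal: for a partition $\mu\vdash N$, $I_\mu\subset K[y_1,\dots,y_N]$ is the ideal generated by the Specht polynomials of all tableaux $T$ of shape $\mu$ (bijective fillings with $1,\dots,N$); the Specht polynomial of $T$ is the product over the columns of $T$ of the Vandermonde products $\prod(y_a-y_b)$ over pairs of entries $a,b$ in that column (one factor for each pair; empty products equal $1$). Definition of $I_{(\mu,z)}$: let $0\le z\le n$ and $\mu\vdash n-z$. For $S=\{i_1<\dots<i_{n-z}\}\subset\{1,\dots,n\}$, let $\phi_S:K[y_1,\dots,y_{n-z}]\to K[x_{i_1},\dots,x_{i_{n-z}}]$ be the $K$-algebra homomorphism $y_j\mapsto x_{i_j}^r$, and let $X_S=(x_j:j\notin S)\subset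 K[x_1,\dots,x_n]$. Let $I_{\ge z+1}$ be the ideal of $K[x_1,\dots,x_n]$ generated by all squarefree monomials of degree $n-z$. Then $$I_{(\mu,z)}:=\Big[\bigcap_{S\subset\{1,\dots,n\},\,|S|=n-z}\big(X_S+\phi_S(I_\mu)\big)\Big]\cap I_{\ge z+1},$$ where $X_S+\phi_S(I_\mu)$ denotes the ideal of $K[x_1,\dots,x_n]$ generated by $X_S$ and $\phi_S(I_\mu)$. *)

theory Defs
  imports
    "HOL-Library.Poly_Mapping"
    "HOL-Library.FuncSet"
    "HOL-Computational_Algebra.Polynomial"
    "HOL-Combinatorics.Permutations"
    "HOL-Algebra.Ideal"
begin

(* Polynomials over 'k in the variables indexed by the natural numbers, as finitely supported
   coefficient functions on exponent vectors. The ring K[x_1, ..., x_n] is the subring poly_ring n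
   of the polynomials that involve only the variables with index in {1..n}. *)
type_synonym 'k mpoly = "(nat \<Rightarrow>\<^sub>0 nat) \<Rightarrow>\<^sub>0 'k"

definition poly_ring :: "nat \<Rightarrow> 'k::field mpoly ring" where
  "poly_ring n =
     \<lparr>carrier = {p. \<forall>m\<in>Poly_Mapping.keys p. Poly_Mapping.keys m \<subseteq> {1..n}},
      monoid.mult = (*), one = 1, zero = 0, add = (+)\<rparr>"

definition Var :: "nat \<Rightarrow> 'k::field mpoly" where
  "Var i = Poly_Mapping.single (Poly_Mapping.single i 1) 1"

definition Const :: "'k \<Rightarrow> 'k::field mpoly" where
  "Const c = Poly_Mapping.single 0 c"

(* The K-algebra homomorphism determined by x_i \<mapsto> f i. *)
definition subst :: "(nat \<Rightarrow> 'k mpoly) \<Rightarrow> 'k::field mpoly \<Rightarrow> 'k mpoly" where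
  "subst f p = (\<Sum>m\<in>Poly_Mapping.keys p. Const (Poly_Mapping.lookup p m) *
                  (\<Prod>i\<in>Poly_Mapping.keys m. f i ^ Poly_Mapping.lookup m i))"

(* genideal is an intersection over all I with "ideal I R", which includes "ring R";
   this lemma ensures that it is not an intersection over the empty family. *)
lemma cring_poly_ring: "cring (poly_ring n :: 'k::field mpoly ring)"
proof -
  have mult: "Poly_Mapping.keys m \<subseteq> {1..n}"
    if m: "m \<in> Poly_Mapping.keys (p * q)"
      and p: "\<forall>m\<in>Poly_Mapping.keys p. Poly_Mapping.keys m \<subseteq> {1..n}"
      and q: "\<forall>m\<in>Poly_Mapping.keys q. Poly_Mapping.keys m \<subseteq> {1..n}"
    for m and p q :: "'k mpoly"
  proof -
    obtain a b where "a \<in> Poly_Mapping.keys p" "b \<in> Poly_Mapping.keys q" "m = a + b"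
      using m keys_mult[of p q] by blast
    then show ?thesis
      using p q Poly_Mapping.keys_add[of a b] by blast
  qed
  have add: "Poly_Mapping.keys m \<subseteq> {1..n}"
    if "m \<in> Poly_Mapping.keys (p + q)"
      and "\<forall>m\<in>Poly_Mapping.keys p. Poly_Mapping.keys m \<subseteq> {1..n}"
      and "\<forall>m\<in>Poly_Mapping.keys q. Poly_Mapping.keys m \<subseteq> {1..n}"
    for m and p q :: "'k mpoly"
    using that Poly_Mapping.keys_add[of p q] by blast
  show ?thesis
  proof (rule cringI)
    show "abelian_group (poly_ring n :: 'k mpoly ring)"
    proof (rule abelian_groupI)
      fix x :: "'k mpoly" assume "x \<in> carrier (poly_ring n)"
      then show "\<exists>y\<in>carrier (poly_ring n). y \<oplus>\<^bsub>poly_ring n\<^esub> x = \<zero>\<^bsub>poly_ring n\<^esub>"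
        by (intro bexI[of _ "- x"]) (auto simp: poly_ring_def)
    qed (use add in \<open>auto simp: poly_ring_def algebra_simps\<close>)
    show "comm_monoid (poly_ring n :: 'k mpoly ring)"
      by (rule comm_monoidI) (use mult in \<open>auto simp: poly_ring_def algebra_simps\<close>)
  qed (auto simp: poly_ring_def algebra_simps)
qed

definition is_partition :: "nat list \<Rightarrow> nat \<Rightarrow> bool" where
  "is_partition \<mu> N \<longleftrightarrow> sorted_wrt (\<ge>) \<mu> \<and> 0 \<notin> set \<mu> \<and> sum_list \<mu> = N"

(* Cells are (row, column), both counted from 0. *)
definition young_diagram :: "nat list \<Rightarrow> (nat \<times> nat) set" where
  "young_diagram \<mu> = {(i, j). i < length \<mu> \<and> j < \<mu> ! i}"

definition tableaux :: "nat list \<Rightarrow> (nat \<times> nat \<Rightarrow> nat) set" where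
  "tableaux \<mu> = {T. bij_betw T (young_diagram \<mu>) {1..sum_list \<mu>}}"

(* Each pair of entries of a column contributes one factor, oriented as (upper - lower);
   another orientation only changes the sign. *)
definition specht_poly :: "nat list \<Rightarrow> (nat \<times> nat \<Rightarrow> nat) \<Rightarrow> 'k::field mpoly" where
  "specht_poly \<mu> T =
     (\<Prod>j\<in>snd ` young_diagram \<mu>.
        \<Prod>(i, i') | (i, j) \<in> young_diagram \<mu> \<and> (i', j) \<in> young_diagram \<mu> \<and> i < i'.
          Var (T (i, j)) - Var (T (i', j)))"

definition specht_ideal :: "nat list \<Rightarrow> 'k::field mpoly set" where
  "specht_ideal \<mu> = Idl\<^bsub>poly_ring (sum_list \<mu>)\<^esub> (specht_poly \<mu> ` tableaux \<mu>)"

definition phi :: "nat \<Rightarrow> nat set \<Rightarrow> 'k::field mpoly \<Rightarrow> 'k mpoly" where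
  "phi r S = subst (\<lambda>j. Var (sorted_list_of_set S ! (j - 1)) ^ r)"

definition X_ideal :: "nat \<Rightarrow> nat set \<Rightarrow> 'k::field mpoly set" where
  "X_ideal n S = Idl\<^bsub>poly_ring n\<^esub> (Var ` ({1..n} - S))"

(* The ideal I_{\<ge> z+1}. *)
definition I_ge_Suc :: "nat \<Rightarrow> nat \<Rightarrow> 'k::field mpoly set" where
  "I_ge_Suc n z = Idl\<^bsub>poly_ring n\<^esub> {\<Prod>i\<in>S. Var i | S. S \<subseteq> {1..n} \<and> card S = n - z}"

definition I_ideal :: "nat \<Rightarrow> nat \<Rightarrow> nat list \<Rightarrow> nat \<Rightarrow> 'k::field mpoly set" where
  "I_ideal r n \<mu> z =
     (\<Inter>S\<in>{S. S \<subseteq> {1..n} \<and> card S = n - z}.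
        Idl\<^bsub>poly_ring n\<^esub> (X_ideal n S \<union> phi r S ` specht_ideal \<mu>)) \<inter> I_ge_Suc n z"

definition roots_of_unity :: "nat \<Rightarrow> 'k::field set" where
  "roots_of_unity r = {\<eta>. \<eta> ^ r = 1}"

(* The underlying set of G(r,1,n). *)
definition G_r1 :: "nat \<Rightarrow> nat \<Rightarrow> ((nat \<Rightarrow> 'k::field) \<times> (nat \<Rightarrow> nat)) set" where
  "G_r1 r n = ({1..n} \<rightarrow>\<^sub>E roots_of_unity r) \<times> {\<sigma>. \<sigma> permutes {1..n}}"

definition G_act :: "(nat \<Rightarrow> 'k::field) \<times> (nat \<Rightarrow> nat) \<Rightarrow> 'k mpoly \<Rightarrow> 'k mpoly" where
  "G_act g = (case g of (\<eta>, \<sigma>) \<Rightarrow> subst (\<lambda>i. Const (\<eta> (\<sigma> i)) * Var (\<sigma> i)))"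

end

(* Every g = (\<eta>; \<sigma>) acts by a substitution x_i \<mapsto> \<eta>_{\<sigma>(i)} x_{\<sigma>(i)}, hence by a ring homomorphism, so it
   suffices to see what it does to the generators of the ideals involved. It multiplies squarefree
   monomials and variables by scalars while permuting them, and since \<eta>_i^r = 1 it sends
   \<phi>_S(y_j) to \<phi>_{\<sigma>(S)}(y_{\<pi>(j)}) for a permutation \<pi> of the indices; \<pi> in turn maps Specht
   polynomials to Specht polynomials. So g maps the component of S into the component of \<sigma>(S), and
   applying this to the inverse of g as well gives equality. *)
theory Submission imports Defs "HOL-Algebra.RingHom" begin

section \<open>Polynomial rings and substitutions\<close>

text \<open>Induction over terms, without freshness conditions on the added term. This suits
  additive maps, for which only single terms remain to be checked.\<close>

lemma poly_mapping_single_induct [case_names zero add]: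
  assumes "P 0" and "\<And>p m c. P p \<Longrightarrow> P (p + Poly_Mapping.single m c)"
  shows "P p"
proof (induction p rule: Poly_Mapping.update_induct)
  case (update p m c)
  \<comment> \<open>At a key outside the support the old coefficient is 0, so overwriting it is the
    same as adding to it.\<close>
  have "Poly_Mapping.update m c p = p + Poly_Mapping.single m c"
    using update.hyps
    by (intro poly_mapping_eqI) (auto simp: lookup_update lookup_add lookup_single in_keys_iff)
  with update assms(2) show ?case by simp
qed (fact assms(1))

lemma ring_poly_ring: "ring (poly_ring n :: 'k::field mpoly ring)"
  using cring_poly_ring cring.axioms(1) by blast

lemma poly_ring_sel [simp]:
  "p \<otimes>\<^bsub>poly_ring n\<^esub> q = p * q" "p \<oplus>\<^bsub>poly_ring n\<^esub> q = p + q"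
  "\<one>\<^bsub>poly_ring n\<^esub> = 1" "\<zero>\<^bsub>poly_ring n\<^esub> = 0"
  by (simp_all add: poly_ring_def)

lemma
  fixes p q :: "'k::field mpoly"
  assumes "p \<in> carrier (poly_ring n)" "q \<in> carrier (poly_ring n)"
  shows poly_ring_add_closed: "p + q \<in> carrier (poly_ring n)"
    and poly_ring_mult_closed: "p * q \<in> carrier (poly_ring n)"
    and poly_ring_diff_closed: "p - q \<in> carrier (poly_ring n)"
proof -
  interpret ring "poly_ring n :: 'k mpoly ring" by (rule ring_poly_ring)
  show "p + q \<in> carrier (poly_ring n)" "p * q \<in> carrier (poly_ring n)"
    using assms a_closed[of p q] m_closed[of p q] by simp_all
  show "p - q \<in> carrier (poly_ring n)"
    using assms keys_diff[of p q] by (fastforce simp: poly_ring_def)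
qed

lemma Const_closed: "Const c \<in> carrier (poly_ring n)"
  by (auto simp: Const_def poly_ring_def)

lemma Var_closed: "i \<in> {1..n} \<Longrightarrow> Var i \<in> carrier (poly_ring n)"
  by (auto simp: Var_def poly_ring_def)

lemma poly_ring_0_closed: "0 \<in> carrier (poly_ring n)"
  and poly_ring_1_closed: "1 \<in> carrier (poly_ring n)"
  by (simp_all add: poly_ring_def)

lemma poly_ring_keysD:
  "\<lbrakk>p \<in> carrier (poly_ring n); m \<in> Poly_Mapping.keys p; i \<in> Poly_Mapping.keys m\<rbrakk> \<Longrightarrow> i \<in> {1..n}"
  unfolding poly_ring_def by (simp del: atLeastAtMost_iff) blast

lemma poly_ring_sum_closed:
  "(\<And>a. a \<in> A \<Longrightarrow> f a \<in> carrier (poly_ring n)) \<Longrightarrow> sum f A \<in> carrier (poly_ring n)"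
  by (induction A rule: infinite_finite_induct)
     (simp_all add: poly_ring_add_closed poly_ring_0_closed)

lemma poly_ring_prod_closed:
  "(\<And>a. a \<in> A \<Longrightarrow> f a \<in> carrier (poly_ring n)) \<Longrightarrow> prod f A \<in> carrier (poly_ring n)"
  by (induction A rule: infinite_finite_induct)
     (simp_all add: poly_ring_mult_closed poly_ring_1_closed)

lemma poly_ring_power_closed:
  "p \<in> carrier (poly_ring n) \<Longrightarrow> p ^ k \<in> carrier (poly_ring n)"
  by (induction k) (simp_all add: poly_ring_mult_closed poly_ring_1_closed)

lemmas poly_ring_closed = poly_ring_mult_closed poly_ring_diff_closed
  Const_closed Var_closed poly_ring_sum_closed poly_ring_prod_closed poly_ring_power_closed

section \<open>Constants, and substitution as a homomorphism of algebras\<close>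

lemma Const_0 [simp]: "Const 0 = 0"
  by (simp add: Const_def)

lemma Const_1 [simp]: "Const 1 = 1"
  by (simp add: Const_def)

lemma Const_add: "Const (a + b) = Const a + Const b"
  by (simp add: Const_def single_add)

lemma Const_mult: "Const (a * b) = Const a * Const b"
  by (simp add: Const_def mult_single)

lemma Const_power: "Const (a ^ k) = Const a ^ k"
  by (induction k) (simp_all add: Const_mult)

text \<open>The inner product of \<open>subst\<close>, named so that its multiplicativity in the
  exponent vector can be stated.\<close>

definition monom_subst :: "(nat \<Rightarrow> 'k mpoly) \<Rightarrow> (nat \<Rightarrow>\<^sub>0 nat) \<Rightarrow> 'k::field mpoly" where
  "monom_subst f m = (\<Prod>i\<in>Poly_Mapping.keys m. f i ^ Poly_Mapping.lookup m i)"

text \<open>Additional indices have exponent 0 and contribute factors 1. Several monomials can thus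
  be compared over one index set.\<close>

lemma monom_subst_superset:
  assumes "finite A" "Poly_Mapping.keys m \<subseteq> A"
  shows "monom_subst f m = (\<Prod>i\<in>A. f i ^ Poly_Mapping.lookup m i)"
  unfolding monom_subst_def
  by (rule prod.mono_neutral_left) (use assms in \<open>auto simp: in_keys_iff\<close>)

lemma monom_subst_0 [simp]: "monom_subst f 0 = 1"
  by (simp add: monom_subst_def)

lemma monom_subst_add: "monom_subst f (m + m') = monom_subst f m * monom_subst f m'"
proof -
  let ?A = "Poly_Mapping.keys m \<union> Poly_Mapping.keys m'"
  have "monom_subst f (m + m') = (\<Prod>i\<in>?A. f i ^ Poly_Mapping.lookup (m + m') i)"
    by (rule monom_subst_superset) (use Poly_Mapping.keys_add[of m m'] in auto)
  also have "\<dots> = (\<Prod>i\<in>?A. f i ^ Poly_Mapping.lookup m i) * (\<Prod>i\<in>?A. f i ^ Poly_Mapping.lookup m' i)"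
    by (simp add: lookup_add power_add prod.distrib)
  also have "\<dots> = monom_subst f m * monom_subst f m'"
    by (simp add: monom_subst_superset[of ?A])
  finally show ?thesis .
qed

text \<open>Additional terms have coefficient 0. A common index set is needed for sums, because
  cancellation can make the support of \<open>p + q\<close> smaller than the union of the
  supports.\<close>

lemma subst_superset:
  assumes "finite A" "Poly_Mapping.keys p \<subseteq> A"
  shows "subst f p = (\<Sum>m\<in>A. Const (Poly_Mapping.lookup p m) * monom_subst f m)"
  unfolding subst_def monom_subst_def
  by (rule sum.mono_neutral_left) (use assms in \<open>auto simp: in_keys_iff\<close>)

lemma subst_add: "subst f (p + q) = subst f p + subst f q"
proof -
  let ?A = "Poly_Mapping.keys p \<union> Poly_Mapping.keys q"
  have "subst f (p + q) = (\<Sum>m\<in>?A. Const (Poly_Mapping.lookup (p + q) m) * monom_subst f m)"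
    by (rule subst_superset) (use Poly_Mapping.keys_add[of p q] in auto)
  also have "\<dots> = subst f p + subst f q"
    by (simp add: subst_superset[of ?A] lookup_add Const_add distrib_right sum.distrib)
  finally show ?thesis .
qed

lemma subst_single: "subst f (Poly_Mapping.single m c) = Const c * monom_subst f m"
  by (subst subst_superset[of "{m}"]) auto

lemma subst_0 [simp]: "subst f 0 = 0"
  by (simp add: subst_def)

lemma subst_Const: "subst f (Const c) = Const c"
  using subst_single[of f 0 c] by (simp add: Const_def)

lemma subst_1 [simp]: "subst f 1 = 1"
  using subst_Const[of f 1] by simp

lemma subst_Var: "subst f (Var i) = f i"
  by (simp add: Var_def subst_single monom_subst_def)

lemma subst_diff: "subst f (p - q) = subst f p - subst f q"
  using subst_add[of f "p - q" q] by simp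

text \<open>By additivity in each factor the claim reduces to two single terms, where it is
  \<open>monom_subst_add\<close>.\<close>

lemma subst_mult: "subst f (p * q) = subst f p * subst f q"
proof (induction p rule: poly_mapping_single_induct)
  case (add p m c)
  have "subst f (Poly_Mapping.single m c * q) = subst f (Poly_Mapping.single m c) * subst f q"
  proof (induction q rule: poly_mapping_single_induct)
    case (add q m' d)
    then show ?case
      by (simp add: distrib_left subst_add mult_single subst_single monom_subst_add Const_mult ac_simps)
  qed simp
  with add show ?case by (simp add: distrib_right subst_add)
qed simp

lemma subst_prod: "subst f (\<Prod>a\<in>A. h a) = (\<Prod>a\<in>A. subst f (h a))"
  by (induction A rule: infinite_finite_induct) (simp_all add: subst_mult)

lemma subst_power: "subst f (p ^ k) = subst f p ^ k"
  by (induction k) (simp_all add: subst_mult)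

lemma subst_subst: "subst f (subst g p) = subst (\<lambda>i. subst f (g i)) p"
proof (induction p rule: poly_mapping_single_induct)
  case (add p m c)
  then show ?case
    by (simp add: subst_add subst_single subst_mult subst_Const monom_subst_def subst_prod subst_power)
qed simp

text \<open>Only variables with index in \<open>{1..n}\<close> occur in \<open>p\<close>. This
  matters below, where the maps to be compared are controlled only on an initial range of
  indices.\<close>

lemma subst_cong:
  assumes "p \<in> carrier (poly_ring n)" "\<And>i. i \<in> {1..n} \<Longrightarrow> f i = g i"
  shows "subst f p = subst g p"
  unfolding subst_def
  by (intro sum.cong prod.cong refl arg_cong2[where f = "(*)"] arg_cong2[where f = "(^)"])
     (use assms poly_ring_keysD in blast)

lemma subst_Var_id: "subst Var p = p"
proof (induction p rule: poly_mapping_single_induct)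
  case (add p m c)
  have pow: "Var i ^ k = Poly_Mapping.single (Poly_Mapping.single i k) (1::'a)" for i k
    by (induction k) (simp_all add: Var_def mult_single flip: single_add)
  have prod: "(\<Prod>i\<in>A. Poly_Mapping.single (h i) 1) = Poly_Mapping.single (sum h A) (1::'a)"
    if "finite A" for h :: "nat \<Rightarrow> nat \<Rightarrow>\<^sub>0 nat" and A
    using that by induction (simp_all add: mult_single)
  \<comment> \<open>The exponent vector is the sum of its coordinates, so the product of the powers
    of the variables is the monomial itself.\<close>
  have m: "(\<Sum>i\<in>Poly_Mapping.keys m. Poly_Mapping.single i (Poly_Mapping.lookup m i)) = m"
    by (intro poly_mapping_eqI)
       (auto simp: lookup_sum lookup_single when_def in_keys_iff sum.delta)
  have "monom_subst Var m = Poly_Mapping.single m (1::'a)"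
    by (simp add: monom_subst_def pow prod m)
  with add show ?case
    by (simp add: subst_add subst_single Const_def mult_single)
qed simp

lemma subst_closed:
  assumes "p \<in> carrier (poly_ring n)" "\<And>i. i \<in> {1..n} \<Longrightarrow> f i \<in> carrier (poly_ring k)"
  shows "subst f p \<in> carrier (poly_ring k)"
  unfolding subst_def
  by (intro poly_ring_closed assms(2)) (use assms(1) poly_ring_keysD in blast)

section \<open>Ideals\<close>

lemma (in ring_hom_ring) ideal_preimage:
  assumes "ideal J S"
  shows "ideal {x \<in> carrier R. h x \<in> J} R"
proof -
  interpret J: ideal J S by fact
  show ?thesis
  proof (rule idealI)
    show "subgroup {x \<in> carrier R. h x \<in> J} (add_monoid R)"
      by (rule R.add.subgroupI) (auto intro!: exI[of _ "\<zero>"] simp flip: a_inv_def)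
  qed (auto intro: R.ring_axioms J.I_l_closed J.I_r_closed)
qed

lemma genideal_closed:
  "X \<subseteq> carrier (poly_ring n) \<Longrightarrow> Idl\<^bsub>poly_ring n\<^esub> X \<subseteq> carrier (poly_ring n)"
  by (rule additive_subgroup.a_subset[OF ideal.axioms(1)])
     (rule ring.genideal_ideal[OF ring_poly_ring])

lemma ideal_poly_ring_mult:
  assumes "ideal J (poly_ring n)" "p \<in> carrier (poly_ring n)" "q \<in> J"
  shows "p * q \<in> J"
  using ideal.I_l_closed[OF assms(1,3,2)] by simp

text \<open>The polynomials that \<open>subst f\<close> sends into \<open>J\<close> form an ideal by
  \<open>ideal_preimage\<close>; it contains \<open>X\<close>, hence the ideal generated by
  \<open>X\<close>. All later inclusions are reduced to generators in this way.\<close>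

lemma subst_genideal:
  fixes f :: "nat \<Rightarrow> 'k::field mpoly"
  assumes f: "\<And>i. i \<in> {1..n} \<Longrightarrow> f i \<in> carrier (poly_ring k)"
    and X: "X \<subseteq> carrier (poly_ring n)"
    and J: "ideal J (poly_ring k)"
    and XJ: "\<And>p. p \<in> X \<Longrightarrow> subst f p \<in> J"
    and p: "p \<in> Idl\<^bsub>poly_ring n\<^esub> X"
  shows "subst f p \<in> J"
proof -
  interpret ring_hom_ring "poly_ring n" "poly_ring k" "subst f"
    by (rule ring_hom_ringI)
       (use f in \<open>auto simp: subst_mult subst_add ring_poly_ring intro: subst_closed\<close>)
  have "Idl\<^bsub>poly_ring n\<^esub> X \<subseteq> {p \<in> carrier (poly_ring n). subst f p \<in> J}"
    by (rule R.genideal_minimal[OF ideal_preimage[OF J]]) (use X XJ in auto)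
  with p show ?thesis by blast
qed

section \<open>Specht ideals\<close>

lemma specht_poly_closed:
  assumes "T \<in> tableaux \<mu>"
  shows "specht_poly \<mu> T \<in> carrier (poly_ring (sum_list \<mu>))"
  unfolding specht_poly_def split_def using assms
  by (intro poly_ring_closed) (auto simp: tableaux_def bij_betw_def)

lemma specht_ideal_closed: "specht_ideal \<mu> \<subseteq> carrier (poly_ring (sum_list \<mu>))"
  unfolding specht_ideal_def by (rule genideal_closed) (auto intro: specht_poly_closed)

text \<open>The substitution acts on each factor separately. No sign appears, because factors are
  oriented by the position of the cells and not by the size of the entries.\<close>

lemma subst_specht_poly: "subst (\<lambda>j. Var (\<pi> j)) (specht_poly \<mu> T) = specht_poly \<mu> (\<pi> \<circ> T)"
  by (simp add: specht_poly_def subst_prod split_def subst_diff subst_Var)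

text \<open>Relabelling the entries of a tableau by a bijection gives a tableau of the same shape,
  so generators go to generators.\<close>

lemma subst_specht_ideal:
  assumes \<pi>: "bij_betw \<pi> {1..sum_list \<mu>} {1..sum_list \<mu>}" and p: "p \<in> specht_ideal \<mu>"
  shows "subst (\<lambda>j. Var (\<pi> j)) p \<in> specht_ideal \<mu>"
  using p unfolding specht_ideal_def
proof (rule subst_genideal[rotated -1])
  show sub: "specht_poly \<mu> ` tableaux \<mu> \<subseteq> carrier (poly_ring (sum_list \<mu>))"
    by (auto intro: specht_poly_closed)
  show "ideal (Idl\<^bsub>poly_ring (sum_list \<mu>)\<^esub> (specht_poly \<mu> ` tableaux \<mu>)) (poly_ring (sum_list \<mu>))"
    by (rule ring.genideal_ideal[OF ring_poly_ring sub])
  show "Var (\<pi> i) \<in> carrier (poly_ring (sum_list \<mu>))" if "i \<in> {1..sum_list \<mu>}" for i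
    by (rule Var_closed) (use that \<pi> in \<open>auto simp: bij_betw_def\<close>)
  fix q :: "'a mpoly" assume "q \<in> specht_poly \<mu> ` tableaux \<mu>"
  then obtain T where T: "T \<in> tableaux \<mu>" "q = specht_poly \<mu> T" by blast
  then have "\<pi> \<circ> T \<in> tableaux \<mu>"
    using \<pi> by (auto simp: tableaux_def intro: bij_betw_trans)
  then show "subst (\<lambda>j. Var (\<pi> j)) q \<in> Idl\<^bsub>poly_ring (sum_list \<mu>)\<^esub> (specht_poly \<mu> ` tableaux \<mu>)"
    using ring.genideal_self[OF ring_poly_ring sub] T(2) by (auto simp: subst_specht_poly)
qed

section \<open>The group action\<close>

lemma sorted_list_of_set_nth_bij:
  assumes "finite S"
  shows "bij_betw (\<lambda>j. sorted_list_of_set S ! (j - 1)) {1..card S} S"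
proof -
  \<comment> \<open>Variables are numbered from 1, list positions from 0.\<close>
  have "bij_betw (\<lambda>j. j - 1) {1..card S} {..<card S}"
    by (rule bij_betwI[of _ _ _ Suc]) auto
  moreover have "bij_betw ((!) (sorted_list_of_set S)) {..<card S} S"
    using assms by (intro bij_betw_nth) auto
  ultimately show ?thesis
    by (auto dest: bij_betw_trans simp: o_def)
qed

lemma G_act_eq: "G_act (\<eta>, \<sigma>) = subst (\<lambda>i. Const (\<eta> (\<sigma> i)) * Var (\<sigma> i))"
  by (simp add: G_act_def)

lemma G_act_closed_Var:
  assumes "\<sigma> permutes {1..n}" "i \<in> {1..n}"
  shows "Const (\<eta> (\<sigma> i)) * Var (\<sigma> i) \<in> carrier (poly_ring n)"
  by (intro poly_ring_closed) (simp only: permutes_in_image[OF assms(1)] assms(2))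

lemma G_act_genideal:
  assumes \<sigma>: "\<sigma> permutes {1..n}" and X: "X \<subseteq> carrier (poly_ring n)" and J: "ideal J (poly_ring n)"
    and XJ: "\<And>p. p \<in> X \<Longrightarrow> G_act (\<eta>, \<sigma>) p \<in> J" and p: "p \<in> Idl\<^bsub>poly_ring n\<^esub> X"
  shows "G_act (\<eta>, \<sigma>) p \<in> J"
  unfolding G_act_eq
proof (rule subst_genideal[OF _ X J _ p])
  show "Const (\<eta> (\<sigma> i)) * Var (\<sigma> i) \<in> carrier (poly_ring n)" if "i \<in> {1..n}" for i
    by (rule G_act_closed_Var[OF \<sigma> that])
qed (fact XJ[unfolded G_act_eq])

lemma phi_closed:
  assumes "S \<subseteq> {1..n}" "p \<in> carrier (poly_ring (card S))"
  shows "phi r S p \<in> carrier (poly_ring n)"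
  unfolding phi_def
proof (rule subst_closed[OF assms(2)])
  fix i assume i: "i \<in> {1..card S}"
  have "finite S" using assms(1) by (rule finite_subset) simp
  from bspec[OF bij_betwE[OF sorted_list_of_set_nth_bij[OF this]] i] assms(1)
  have "sorted_list_of_set S ! (i - 1) \<in> {1..n}" by (rule subsetD[rotated])
  then show "Var (sorted_list_of_set S ! (i - 1)) ^ r \<in> carrier (poly_ring n)"
    by (intro poly_ring_power_closed Var_closed)
qed

text \<open>The \<open>r\<close>-th powers absorb the roots of unity, so only \<sigma> acts on the
  image of \<open>phi r S\<close>. As \<sigma> need not preserve the order of \<open>S\<close>, it
  carries the increasing enumeration of \<open>S\<close> to some enumeration of the image, and \<pi>
  measures how this differs from the increasing one.\<close>

lemma G_act_phi:
  assumes \<sigma>: "\<sigma> permutes {1..n}" and \<eta>: "\<eta> \<in> {1..n} \<rightarrow> roots_of_unity r" and S: "S \<subseteq> {1..n}"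
  obtains \<pi> where "bij_betw \<pi> {1..card S} {1..card S}"
    and "\<And>p. p \<in> carrier (poly_ring (card S)) \<Longrightarrow>
           G_act (\<eta>, \<sigma>) (phi r S p) = phi r (\<sigma> ` S) (subst (\<lambda>j. Var (\<pi> j)) p)"
proof -
  define s where "s S j = sorted_list_of_set S ! (j - 1)" for S :: "nat set" and j :: nat
  \<comment> \<open>The position of \<sigma>(i) in the increasing enumeration of the image of
    \<open>S\<close>, where i is the \<open>j\<close>-th element of \<open>S\<close>.\<close>
  define \<pi> where "\<pi> = inv_into {1..card S} (s (\<sigma> ` S)) \<circ> (\<sigma> \<circ> s S)"
  have fin: "finite S" using S finite_subset by blast
  have inj: "inj \<sigma>" using \<sigma> permutes_inj by blast
  have card: "card (\<sigma> ` S) = card S"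
    by (rule card_image[OF inj_on_subset[OF inj subset_UNIV]])
  have bS: "bij_betw (s S) {1..card S} S"
    unfolding s_def by (rule sorted_list_of_set_nth_bij[OF fin])
  have bT: "bij_betw (s (\<sigma> ` S)) {1..card S} (\<sigma> ` S)"
    unfolding s_def using sorted_list_of_set_nth_bij[of "\<sigma> ` S"] fin card by simp
  have b\<sigma>: "bij_betw \<sigma> S (\<sigma> ` S)"
    by (rule inj_on_imp_bij_betw[OF inj_on_subset[OF inj subset_UNIV]])
  show ?thesis
  proof (rule that)
    show "bij_betw \<pi> {1..card S} {1..card S}"
      unfolding \<pi>_def
      by (rule bij_betw_trans[OF bij_betw_trans[OF bS b\<sigma>] bij_betw_inv_into[OF bT]])
    fix p :: "'a mpoly" assume p: "p \<in> carrier (poly_ring (card S))"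
    show "G_act (\<eta>, \<sigma>) (phi r S p) = phi r (\<sigma> ` S) (subst (\<lambda>j. Var (\<pi> j)) p)"
      unfolding G_act_eq phi_def subst_subst subst_Var subst_power s_def[symmetric]
    proof (rule subst_cong[OF p])
      fix j assume j: "j \<in> {1..card S}"
      have sj: "s S j \<in> S" by (rule bspec[OF bij_betwE[OF bS] j])
      have "s (\<sigma> ` S) (\<pi> j) = \<sigma> (s S j)"
        unfolding \<pi>_def o_apply by (rule bij_betw_inv_into_right[OF bT imageI[OF sj]])
      moreover have "\<eta> (\<sigma> (s S j)) ^ r = 1"
      proof -
        have "\<sigma> (s S j) \<in> {1..n}"
          using subsetD[OF S sj] by (simp only: permutes_in_image[OF \<sigma>])
        then have "\<eta> (\<sigma> (s S j)) \<in> roots_of_unity r" by (rule funcset_mem[OF \<eta>])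
        then show ?thesis unfolding roots_of_unity_def by (rule CollectD)
      qed
      ultimately show "(Const (\<eta> (\<sigma> (s S j))) * Var (\<sigma> (s S j))) ^ r = Var (s (\<sigma> ` S) (\<pi> j)) ^ r"
        by (simp add: power_mult_distrib flip: Const_power)
    qed
  qed
qed

section \<open>Images of the components, of the squarefree monomial ideal and of their
  intersection\<close>

lemma Var_image_closed: "Var ` ({1..n} - S) \<subseteq> carrier (poly_ring n)"
  by (auto intro: Var_closed)

text \<open>Generators must lie in the carrier for the generated set to be known to be an ideal
  containing them. The cardinality condition matches the variables of the Specht ideal with the
  elements of \<open>S\<close>.\<close>

lemma component_generators_closed:
  assumes "S \<subseteq> {1..n}" "card S = sum_list \<mu>"
  shows "X_ideal n S \<union> phi r S ` specht_ideal \<mu> \<subseteq> carrier (poly_ring n)"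
proof -
  have "phi r S p \<in> carrier (poly_ring n)" if "p \<in> specht_ideal \<mu>" for p :: "'a mpoly"
    by (rule phi_closed[OF assms(1)]) (use that specht_ideal_closed assms(2) in auto)
  then show ?thesis
    unfolding X_ideal_def using genideal_closed[OF Var_image_closed] by blast
qed

text \<open>Variables outside \<open>S\<close> go to multiples of variables outside the image of
  \<open>S\<close>, and the remaining generators are handled by \<open>G_act_phi\<close> and
  \<open>subst_specht_ideal\<close>.\<close>

lemma G_act_component:
  assumes \<sigma>: "\<sigma> permutes {1..n}" and \<eta>: "\<eta> \<in> {1..n} \<rightarrow> roots_of_unity r"
    and S: "S \<subseteq> {1..n}" "card S = sum_list \<mu>"
    and p: "p \<in> Idl\<^bsub>poly_ring n\<^esub> (X_ideal n S \<union> phi r S ` specht_ideal \<mu>)"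
  shows "G_act (\<eta>, \<sigma>) p \<in> Idl\<^bsub>poly_ring n\<^esub> (X_ideal n (\<sigma> ` S) \<union> phi r (\<sigma> ` S) ` specht_ideal \<mu>)"
    (is "_ \<in> ?J")
proof -
  have inj: "inj \<sigma>" using \<sigma> permutes_inj by blast
  have \<sigma>S: "\<sigma> ` S \<subseteq> {1..n}" using image_mono[OF S(1), of \<sigma>] by (simp only: permutes_image[OF \<sigma>])
  have "card (\<sigma> ` S) = sum_list \<mu>"
    using S(2) card_image[OF inj_on_subset[OF inj subset_UNIV]] by simp
  note gens = component_generators_closed[OF \<sigma>S this, where 'a = 'a and r = r]
  have J: "ideal ?J (poly_ring n)"
    by (rule ring.genideal_ideal[OF ring_poly_ring gens])
  have in_J: "X_ideal n (\<sigma> ` S) \<union> phi r (\<sigma> ` S) ` specht_ideal \<mu> \<subseteq> ?J"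
    by (rule ring.genideal_self[OF ring_poly_ring gens])
  \<comment> \<open>\<open>X_ideal n S\<close> is itself a generated ideal, so the test on
    generators is applied a first time here, and again for the whole component at the end.\<close>
  have X: "G_act (\<eta>, \<sigma>) q \<in> ?J" if "q \<in> X_ideal n S" for q
  proof (rule G_act_genideal[OF \<sigma> Var_image_closed J _ that[unfolded X_ideal_def]])
    fix q :: "'a mpoly" assume "q \<in> Var ` ({1..n} - S)"
    then obtain i where i: "i \<in> {1..n}" "i \<notin> S" "q = Var i" by blast
    have "\<sigma> i \<in> {1..n} - \<sigma> ` S"
      using i by (simp only: Diff_iff permutes_in_image[OF \<sigma>] inj_image_mem_iff[OF inj]) simp
    then have "Var (\<sigma> i) \<in> X_ideal n (\<sigma> ` S)"
      unfolding X_ideal_def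
      by (intro subsetD[OF ring.genideal_self[OF ring_poly_ring Var_image_closed]] imageI)
    then have "Var (\<sigma> i) \<in> ?J" by (intro subsetD[OF in_J] UnI1)
    then show "G_act (\<eta>, \<sigma>) q \<in> ?J"
      unfolding i(3) G_act_eq subst_Var by (rule ideal_poly_ring_mult[OF J Const_closed])
  qed
  obtain \<pi> where \<pi>: "bij_betw \<pi> {1..card S} {1..card S}"
    "\<And>p. p \<in> carrier (poly_ring (card S)) \<Longrightarrow>
       G_act (\<eta>, \<sigma>) (phi r S p) = phi r (\<sigma> ` S) (subst (\<lambda>j. Var (\<pi> j)) p)"
    by (rule G_act_phi[OF \<sigma> \<eta> S(1)]) (rule that)
  have phi: "G_act (\<eta>, \<sigma>) (phi r S q) \<in> ?J" if "q \<in> specht_ideal \<mu>" for q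
  proof -
    have "q \<in> carrier (poly_ring (card S))"
      using that specht_ideal_closed S(2) by auto
    then have "G_act (\<eta>, \<sigma>) (phi r S q) = phi r (\<sigma> ` S) (subst (\<lambda>j. Var (\<pi> j)) q)"
      by (rule \<pi>(2))
    moreover have "subst (\<lambda>j. Var (\<pi> j)) q \<in> specht_ideal \<mu>"
      by (rule subst_specht_ideal[OF _ that]) (use \<pi>(1) S(2) in simp)
    ultimately show ?thesis by (intro subsetD[OF in_J] UnI2) (simp only: imageI)
  qed
  show ?thesis
  proof (rule G_act_genideal[OF \<sigma> component_generators_closed[OF S] J _ p])
    fix q :: "'a mpoly" assume "q \<in> X_ideal n S \<union> phi r S ` specht_ideal \<mu>"
    then show "G_act (\<eta>, \<sigma>) q \<in> ?J"
      by (elim UnE imageE) (simp_all only: X phi)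
  qed
qed

lemma squarefree_monomials_closed:
  "{\<Prod>i\<in>S. Var i | S. S \<subseteq> {1..n} \<and> card S = k} \<subseteq> carrier (poly_ring n)"
  by (clarify, intro poly_ring_prod_closed Var_closed) blast

text \<open>The squarefree monomial of \<open>S\<close> goes to a constant times that of its image
  under \<sigma>, a set of the same size. This holds for arbitrary scalars \<eta>.\<close>

lemma G_act_I_ge_Suc:
  assumes \<sigma>: "\<sigma> permutes {1..n}" and p: "p \<in> I_ge_Suc n z"
  shows "G_act (\<eta>, \<sigma>) p \<in> I_ge_Suc n z"
proof -
  have J: "ideal (I_ge_Suc n z :: 'a mpoly set) (poly_ring n)"
    unfolding I_ge_Suc_def
    by (rule ring.genideal_ideal[OF ring_poly_ring squarefree_monomials_closed])
  show ?thesis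
  proof (rule G_act_genideal[OF \<sigma> squarefree_monomials_closed J _ p[unfolded I_ge_Suc_def]])
    fix q :: "'a mpoly" assume "q \<in> {\<Prod>i\<in>S. Var i | S. S \<subseteq> {1..n} \<and> card S = n - z}"
    then obtain S where S: "S \<subseteq> {1..n}" "card S = n - z" "q = (\<Prod>i\<in>S. Var i)" by blast
    have inj: "inj_on \<sigma> S" by (rule inj_on_subset[OF permutes_inj[OF \<sigma>] subset_UNIV])
    have "\<sigma> ` S \<subseteq> {1..n}" using image_mono[OF S(1), of \<sigma>] by (simp only: permutes_image[OF \<sigma>])
    moreover have "card (\<sigma> ` S) = n - z" using S(2) inj by (simp add: card_image)
    ultimately have "(\<Prod>i\<in>\<sigma> ` S. Var i :: 'a mpoly) \<in> I_ge_Suc n z"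
      unfolding I_ge_Suc_def
      using ring.genideal_self[OF ring_poly_ring squarefree_monomials_closed] by blast
    moreover have "G_act (\<eta>, \<sigma>) q = (\<Prod>i\<in>S. Const (\<eta> (\<sigma> i))) * (\<Prod>i\<in>\<sigma> ` S. Var i)"
      using inj by (simp add: S(3) G_act_eq subst_prod subst_Var prod.distrib prod.reindex)
    ultimately show "G_act (\<eta>, \<sigma>) q \<in> I_ge_Suc n z"
      by (simp only: ideal_poly_ring_mult[OF J] poly_ring_prod_closed Const_closed)
  qed
qed

text \<open>The action permutes the components, so membership of the image in the component of
  \<open>S\<close> comes from membership of \<open>p\<close> in the component that is moved
  there.\<close>

lemma G_act_I_ideal:
  assumes \<mu>: "sum_list \<mu> = n - z" and g: "g \<in> G_r1 r n" and p: "p \<in> I_ideal r n \<mu> z"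
  shows "G_act g p \<in> I_ideal r n \<mu> z"
proof -
  obtain \<eta> \<sigma> where g_eq: "g = (\<eta>, \<sigma>)" by (cases g)
  with g have \<sigma>: "\<sigma> permutes {1..n}" and \<eta>: "\<eta> \<in> {1..n} \<rightarrow> roots_of_unity r"
    by (simp_all add: G_r1_def PiE_iff Pi_iff)
  have "G_act (\<eta>, \<sigma>) p \<in> Idl\<^bsub>poly_ring n\<^esub> (X_ideal n S \<union> phi r S ` specht_ideal \<mu>)"
    if S: "S \<subseteq> {1..n}" "card S = n - z" for S
  proof -
    \<comment> \<open>The index set whose component is mapped into that of \<open>S\<close>.\<close>
    define T where "T = Hilbert_Choice.inv \<sigma> ` S"
    have inv: "Hilbert_Choice.inv \<sigma> permutes {1..n}" by (rule permutes_inv[OF \<sigma>])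
    have ST: "\<sigma> ` T = S" by (simp add: T_def image_comp permutes_inv_o[OF \<sigma>])
    have T: "T \<subseteq> {1..n}" unfolding T_def using image_mono[OF S(1)] permutes_image[OF inv] by metis
    have card: "card T = n - z"
      unfolding T_def using S(2) card_image[OF inj_on_subset[OF permutes_inj[OF inv] subset_UNIV]] by simp
    with T p have "p \<in> Idl\<^bsub>poly_ring n\<^esub> (X_ideal n T \<union> phi r T ` specht_ideal \<mu>)"
      by (auto simp: I_ideal_def)
    from G_act_component[OF \<sigma> \<eta> T _ this] show ?thesis
      using card \<mu> by (simp add: ST)
  qed
  moreover have "G_act (\<eta>, \<sigma>) p \<in> I_ge_Suc n z"
    using G_act_I_ge_Suc[OF \<sigma>] p by (auto simp: I_ideal_def)
  ultimately show ?thesis by (auto simp: I_ideal_def g_eq)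
qed

text \<open>A one-sided inverse suffices, as it is used for surjectivity.\<close>

lemma G_act_inverse:
  assumes r: "r > 0" and g: "g \<in> G_r1 r n"
  obtains g' where "g' \<in> G_r1 r n"
    and "\<And>p :: 'k::field mpoly. p \<in> carrier (poly_ring n) \<Longrightarrow> G_act g (G_act g' p) = p"
proof -
  obtain \<eta> \<sigma> where g_eq: "g = (\<eta>, \<sigma>)" by (cases g)
  with g have \<sigma>: "\<sigma> permutes {1..n}" and \<eta>: "\<And>i. i \<in> {1..n} \<Longrightarrow> \<eta> i ^ r = 1"
    by (auto simp: G_r1_def roots_of_unity_def)
  have inv: "Hilbert_Choice.inv \<sigma> permutes {1..n}" by (rule permutes_inv[OF \<sigma>])
  \<comment> \<open>Applying \<open>g'\<close> and then \<open>g\<close> multiplies the i-th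
    variable by \<eta>'(j) \<eta>(i), where i = \<sigma>(j); this forces the formula. The
    restriction to \<open>{1..n}\<close> gives the default value outside that the extensional
    function space in \<open>G_r1\<close> demands.\<close>
  define \<eta>' where "\<eta>' = (\<lambda>j\<in>{1..n}. inverse (\<eta> (\<sigma> j)))"
  show ?thesis
  proof (rule that)
    have "\<eta>' \<in> {1..n} \<rightarrow>\<^sub>E roots_of_unity r"
      using \<eta> permutes_in_image[OF \<sigma>]
      by (auto simp: \<eta>'_def roots_of_unity_def power_inverse)
    then show "(\<eta>', Hilbert_Choice.inv \<sigma>) \<in> G_r1 r n" using inv by (simp add: G_r1_def)
    fix p :: "'k mpoly" assume p: "p \<in> carrier (poly_ring n)"
    have "G_act g (G_act (\<eta>', Hilbert_Choice.inv \<sigma>) p) = subst Var p"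
      unfolding g_eq G_act_eq subst_subst
    proof (rule subst_cong[OF p])
      fix i assume i: "i \<in> {1..n}"
      have \<sigma>i: "\<sigma> (Hilbert_Choice.inv \<sigma> i) = i" using permutes_inverses(1)[OF \<sigma>] .
      have "Hilbert_Choice.inv \<sigma> i \<in> {1..n}" using i by (simp only: permutes_in_image[OF inv])
      \<comment> \<open>Since \<open>r > 0\<close>, the \<open>r\<close>-th power of 0 is 0 and not
        1.\<close>
      moreover have "\<eta> i \<noteq> 0" using \<eta>[OF i] r by (auto simp: zero_power)
      ultimately have "\<eta>' (Hilbert_Choice.inv \<sigma> i) * \<eta> i = 1" by (simp add: \<eta>'_def \<sigma>i)
      then show "subst (\<lambda>i. Const (\<eta> (\<sigma> i)) * Var (\<sigma> i)) (Const (\<eta>' (Hilbert_Choice.inv \<sigma> i)) * Var (Hilbert_Choice.inv \<sigma> i)) = Var i"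
        by (simp add: subst_mult subst_Const subst_Var \<sigma>i mult.assoc[symmetric] flip: Const_mult)
    qed
    then show "G_act g (G_act (\<eta>', Hilbert_Choice.inv \<sigma>) p) = p" by (simp add: subst_Var_id)
  qed
qed

theorem theorem3p2:
  fixes r n z :: nat and \<mu> :: "nat list"
  assumes "r \<ge> 2"
    and "infinite (UNIV :: 'k::field set)"
    and "\<exists>A :: 'k multiset. monom 1 r - 1 = (\<Prod>a\<in>#A. [:- a, 1:])"
    and "z \<le> n"
    and "is_partition \<mu> (n - z)"
  shows "\<forall>g \<in> G_r1 r n. G_act g ` (I_ideal r n \<mu> z :: 'k mpoly set) = I_ideal r n \<mu> z"
proof
  fix g :: "(nat \<Rightarrow> 'k) \<times> (nat \<Rightarrow> nat)" assume g: "g \<in> G_r1 r n"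
  have \<mu>: "sum_list \<mu> = n - z" using assms(5) by (simp add: is_partition_def)
  \<comment> \<open>The inverse identity is available only on the carrier. The factor
    \<open>I_ge_Suc n z\<close> of the intersection already lies in it.\<close>
  have closed: "(I_ideal r n \<mu> z :: 'k mpoly set) \<subseteq> carrier (poly_ring n)"
    using genideal_closed[OF squarefree_monomials_closed] by (auto simp: I_ideal_def I_ge_Suc_def)
  have "r > 0" using assms(1) by simp
  from G_act_inverse[OF this g] obtain g' where g': "g' \<in> G_r1 r n"
    and inv: "\<And>p :: 'k mpoly. p \<in> carrier (poly_ring n) \<Longrightarrow> G_act g (G_act g' p) = p"
    by blast
  show "G_act g ` (I_ideal r n \<mu> z :: 'k mpoly set) = I_ideal r n \<mu> z"
  proof
    show "G_act g ` (I_ideal r n \<mu> z :: 'k mpoly set) \<subseteq> I_ideal r n \<mu> z"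
      using G_act_I_ideal[OF \<mu> g] by blast
    show "(I_ideal r n \<mu> z :: 'k mpoly set) \<subseteq> G_act g ` I_ideal r n \<mu> z"
    proof
      fix p :: "'k mpoly" assume p: "p \<in> I_ideal r n \<mu> z"
      \<comment> \<open>The preimage \<open>G_act g' p\<close> lies in the ideal by the inclusion
        already proved, applied to \<open>g'\<close>.\<close>
      then have "p = G_act g (G_act g' p)" using inv closed by auto
      then show "p \<in> G_act g ` I_ideal r n \<mu> z" using G_act_I_ideal[OF \<mu> g' p] by blast
    qed
  qed
qed

end
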